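(* For every $s\in\mathbb N$, $a>0$, $0<\delta\le 1$ with $\delta<a$, and every $T>0$, $$|\Gamma(s,T,a)|\;<\;\delta^{-1}\,T^{1+1/\delta}\,(a-\delta)^{-s/\delta}$$ and $$|\Gamma_\pm(s,T,a)|\;<\;2\delta^{-1}\,T^{1+2/\delta}\,(a-\delta)^{-2s/\delta}.$$
   Context: For $s\in\mathbb N=\{1,2,\dots\}$, $a>0$, $T>0$: $\Gamma(s,T,a):=\{\mathbf k\in\mathbb N_0^s:\ \prod_{i=1}^s(k_i+a)\le T\}$ and $\Gamma_\pm(s,T,a):=\{\mathbf k\in\mathbb Z^s:\ \prod_{i=1}^s(|k_i|+a)\le T\}$, where $\mathbb N_0=\{0,1,2,\dots\}$. $|G|$ denotes the cardinality of a finite set $G$. *)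

theory Defs
  imports Complex_Main "HOL-Library.FuncSet"
begin

text \<open>
  Vectors in \<open>\<nat>\<^sub>0\<^sup>s\<close> and \<open>\<int>\<^sup>s\<close> are functions on the index set \<open>{1..s}\<close>, required to be
  \<open>undefined\<close> outside of it, so that distinct functions in the sets below are distinct vectors.
\<close>

definition Gamma_nat :: "nat \<Rightarrow> real \<Rightarrow> real \<Rightarrow> (nat \<Rightarrow> nat) set" where
  "Gamma_nat s T a = {k \<in> {1..s} \<rightarrow>\<^sub>E UNIV. (\<Prod>i=1..s. (real (k i) + a)) \<le> T}"

definition Gamma_pm :: "nat \<Rightarrow> real \<Rightarrow> real \<Rightarrow> (nat \<Rightarrow> int) set" where
  "Gamma_pm s T a = {k \<in> {1..s} \<rightarrow>\<^sub>E UNIV. (\<Prod>i=1..s. (real_of_int \<bar>k i\<bar> + a)) \<le> T}"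

end

theory Submission
  imports Defs
begin

text \<open>
  Rankin's trick: every vector counted has \<open>(T / \<Prod>(k\<^sub>i + a))\<^sup>q \<ge> 1\<close>, so the count is at most
  \<open>T\<^sup>q\<close> times the \<open>s\<close>-th power of the one-dimensional sum of \<open>(k + a)\<^sup>-\<^sup>q\<close>, where \<open>q = 1 + p\<close> and
  \<open>p\<close> is \<open>1/\<delta>\<close> or, for integer vectors, \<open>2/\<delta>\<close>. Bernoulli's inequality
  \<open>y\<^sup>-\<^sup>p (1 + p\<delta>/y) < (y - \<delta>)\<^sup>-\<^sup>p\<close> is used twice: with shift 1 in place of \<open>\<delta>\<close> it makes the
  one-dimensional sum telescope, and at \<open>y = a\<close> it bounds the result by \<open>(a - \<delta>)\<^sup>-\<^sup>p\<close>.
\<close>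

text \<open>After division by \<open>y powr (-p)\<close>, this combines \<open>ln x < x - 1\<close>
  at \<open>x = 1 - d/y\<close> with \<open>1 + t \<le> exp t\<close>. The first inequality is
  strict because \<open>d > 0\<close> gives \<open>x \<noteq> 1\<close>.\<close>

lemma powr_shift_Bernoulli:
  fixes y d p :: real
  assumes "0 < d" "d < y" "0 < p"
  shows "y powr (-p) + p * d * y powr (-1-p) < (y - d) powr (-p)"
proof -
  have "ln (1 - d/y) < - (d/y)"
    using assms ln_le_minus_one[of "1 - d/y"] ln_eq_minus_one[of "1 - d/y"] by force
  then have "1 + p * (d/y) < 1 + - p * ln (1 - d/y)"
    using assms mult_strict_left_mono[of "ln (1 - d/y)" "- (d/y)" p] by simp
  also have "\<dots> \<le> exp (- p * ln (1 - d/y))"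
    by (rule exp_ge_add_one_self)
  finally have "1 + p * (d/y) < exp (- p * ln (1 - d/y))" .
  also have "\<dots> = (1 - d/y) powr (-p)"
    using assms by (simp add: powr_def)
  finally have "y powr (-p) * (1 + p * (d/y)) < y powr (-p) * (1 - d/y) powr (-p)"
    using assms by (intro mult_strict_left_mono) auto
  also have "\<dots> = (y - d) powr (-p)"
    using assms by (simp add: powr_mult[symmetric] right_diff_distrib)
  finally show ?thesis
    using assms by (simp add: powr_diff powr_minus field_simps)
qed

lemma sum_powr_nat_le:
  fixes a p :: real
  assumes "0 < a" "0 < p"
  shows "(\<Sum>k\<le>n. (real k + a) powr (-1-p))
           \<le> a powr (-1-p) + (a powr (-p) - (real n + a) powr (-p)) / p"
proof (induction n)
  case (Suc n)
  \<comment> \<open>Shift 1 requires a base above 1. This holds for \<open>Suc n + a\<close>, but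
    may fail for the base \<open>a\<close> at \<open>k = 0\<close>, so that term stays separate in
    the bound.\<close>
  have "p * (real (Suc n) + a) powr (-1-p)
          \<le> (real n + a) powr (-p) - (real (Suc n) + a) powr (-p)"
    using powr_shift_Bernoulli[of 1 "real (Suc n) + a" p] assms by simp
  then have "(real (Suc n) + a) powr (-1-p)
          \<le> ((real n + a) powr (-p) - (real (Suc n) + a) powr (-p)) / p"
    using assms by (simp add: pos_le_divide_eq mult.commute)
  with Suc show ?case by (simp add: diff_divide_distrib)
qed simp

text \<open>Nonzero integers pair up by sign, whereas 0 occurs once and is counted twice by the
  doubled sum.\<close>

lemma sum_powr_int_eq:
  fixes a q :: real
  shows "(\<Sum>k=-int n..int n. (real_of_int \<bar>k\<bar> + a) powr q)
           = 2 * (\<Sum>k\<le>n. (real k + a) powr q) - a powr q"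
proof (induction n)
  case (Suc n)
  have "{-int (Suc n)..int (Suc n)} = insert (-int (Suc n)) (insert (int (Suc n)) {-int n..int n})"
    by auto
  with Suc show ?case by (simp add: add.commute)
qed simp

text \<open>This is the Rankin step for an abstract weight \<open>w\<close>, so that it serves
  natural and integer vectors alike. Bounding all finite sums by \<open>Z\<close> avoids infinite
  series.\<close>

lemma card_prod_le:
  fixes w :: "'b \<Rightarrow> real" and a q T Z :: real and I :: "'i set"
  assumes I: "finite I" and a: "0 < a" "\<And>x. a \<le> w x" and q: "0 \<le> q"
    and fin: "\<And>B. finite {x. w x \<le> B}"
    and Z: "\<And>A. finite A \<Longrightarrow> (\<Sum>x\<in>A. w x powr (-q)) \<le> Z"
  defines "G \<equiv> {k \<in> I \<rightarrow>\<^sub>E UNIV. (\<Prod>i\<in>I. w (k i)) \<le> T}"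
  shows "finite G" "real (card G) \<le> T powr q * Z ^ card I"
proof -
  \<comment> \<open>The other \<open>card I - 1\<close> factors of a product are each at least
    \<open>a\<close>, which caps every single factor for vectors in \<open>G\<close>.\<close>
  define A where "A = {x. w x \<le> T / a ^ (card I - 1)}"
  have pos: "0 < w x" for x using a by (meson less_le_trans)
  have A: "finite A" unfolding A_def by (rule fin)
  have GA: "G \<subseteq> I \<rightarrow>\<^sub>E A"
  proof
    fix k assume k: "k \<in> G"
    have "k i \<in> A" if i: "i \<in> I" for i
    proof -
      have "w (k i) * a ^ (card I - 1) \<le> w (k i) * (\<Prod>j\<in>I-{i}. w (k j))"
        using prod_mono[of "I-{i}" "\<lambda>_. a" "\<lambda>j. w (k j)"] a pos I i
        by (intro mult_left_mono) (auto simp: less_imp_le card_Diff_singleton)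
      also have "\<dots> = (\<Prod>j\<in>I. w (k j))" using I i by (simp add: prod.remove)
      also have "\<dots> \<le> T" using k by (simp add: G_def)
      finally show ?thesis using a by (simp add: A_def pos_le_divide_eq)
    qed
    with k show "k \<in> I \<rightarrow>\<^sub>E A" by (auto simp: G_def PiE_iff)
  qed
  have finP: "finite (I \<rightarrow>\<^sub>E A)" using I A by (intro finite_PiE) auto
  show "finite G" using GA finP by (rule finite_subset)
  have "real (card G) = (\<Sum>k\<in>G. 1)" by simp
  also have "\<dots> \<le> (\<Sum>k\<in>G. T powr q * (\<Prod>i\<in>I. w (k i) powr (-q)))"
  proof (rule sum_mono)
    fix k assume "k \<in> G"
    then have le: "(\<Prod>i\<in>I. w (k i)) \<le> T" by (simp add: G_def)
    have P: "0 < (\<Prod>i\<in>I. w (k i))" using pos by (intro prod_pos) auto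
    have "1 = (\<Prod>i\<in>I. w (k i)) powr q * (\<Prod>i\<in>I. w (k i)) powr (-q)"
      using P by (simp add: powr_add[symmetric])
    also have "\<dots> \<le> T powr q * (\<Prod>i\<in>I. w (k i)) powr (-q)"
      using le P q by (intro mult_right_mono powr_mono2) auto
    also have "(\<Prod>i\<in>I. w (k i)) powr (-q) = (\<Prod>i\<in>I. w (k i) powr (-q))"
      using pos by (simp add: prod_powr_distrib less_imp_le)
    finally show "1 \<le> T powr q * (\<Prod>i\<in>I. w (k i) powr (-q))" .
  qed
  \<comment> \<open>Over the full box \<open>I \<rightarrow>\<^sub>E A\<close> the sum of products
    factors into a power of a single sum.\<close>
  also have "\<dots> \<le> (\<Sum>k\<in>I \<rightarrow>\<^sub>E A. T powr q * (\<Prod>i\<in>I. w (k i) powr (-q)))"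
    using finP GA by (intro sum_mono2) (auto intro!: mult_nonneg_nonneg prod_nonneg)
  also have "\<dots> = T powr q * (\<Sum>x\<in>A. w x powr (-q)) ^ card I"
    using prod_sum_PiE[OF I A, of "\<lambda>_ x. w x powr (-q)"] by (simp add: sum_distrib_left[symmetric])
  also have "\<dots> \<le> T powr q * Z ^ card I"
    using Z[OF A] by (intro mult_left_mono power_mono) (auto intro!: sum_nonneg)
  finally show "real (card G) \<le> T powr q * Z ^ card I" .
qed

lemma sum_powr_nat_finite_le:
  fixes a p :: real
  assumes "0 < a" "0 < p" "finite A"
  shows "(\<Sum>k\<in>A. (real k + a) powr (-(1+p))) \<le> a powr (-1-p) + a powr (-p) / p"
proof -
  obtain n where "A \<subseteq> {..n}" using assms finite_nat_set_iff_bounded_le[of A] by (auto simp: subset_eq)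
  then have "(\<Sum>k\<in>A. (real k + a) powr (-1-p)) \<le> (\<Sum>k\<le>n. (real k + a) powr (-1-p))"
    by (intro sum_mono2) auto
  also have "\<dots> \<le> a powr (-1-p) + (a powr (-p) - (real n + a) powr (-p)) / p"
    using assms by (intro sum_powr_nat_le) auto
  also have "\<dots> \<le> a powr (-1-p) + a powr (-p) / p"
    using assms by (simp add: divide_right_mono)
  finally show ?thesis by simp
qed

lemma sum_powr_int_finite_le:
  fixes a p :: real
  assumes "0 < a" "0 < p" "finite A"
  shows "(\<Sum>k\<in>A. (real_of_int \<bar>k\<bar> + a) powr (-(1+p))) \<le> a powr (-1-p) + 2 * a powr (-p) / p"
proof -
  \<comment> \<open>Inserting 0 keeps the maximum meaningful for empty \<open>A\<close>.\<close>
  define n where "n = Max (insert 0 ((\<lambda>k. nat \<bar>k\<bar>) ` A))"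
  have "nat \<bar>k\<bar> \<le> n" if "k \<in> A" for k
    unfolding n_def using assms that by (intro Max_ge) auto
  then have "A \<subseteq> {-int n..int n}" by force
  then have "(\<Sum>k\<in>A. (real_of_int \<bar>k\<bar> + a) powr (-1-p))
      \<le> (\<Sum>k=-int n..int n. (real_of_int \<bar>k\<bar> + a) powr (-1-p))"
    by (intro sum_mono2) auto
  also have "\<dots> = 2 * (\<Sum>k\<le>n. (real k + a) powr (-1-p)) - a powr (-1-p)"
    by (rule sum_powr_int_eq)
  also have "\<dots> \<le> 2 * (a powr (-1-p) + a powr (-p) / p) - a powr (-1-p)"
    using sum_powr_nat_finite_le[of a p "{..n}"] assms by simp
  finally show ?thesis by simp
qed

theorem corollary3p5:
  fixes s :: nat and a \<delta> T :: real
  assumes "s \<ge> 1" and "a > 0" and "0 < \<delta>" and "\<delta> \<le> 1" and "\<delta> < a" and "T > 0"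
  shows "finite (Gamma_nat s T a)
       \<and> real (card (Gamma_nat s T a))
           < inverse \<delta> * T powr (1 + 1 / \<delta>) * (a - \<delta>) powr (- real s / \<delta>)
       \<and> finite (Gamma_pm s T a)
       \<and> real (card (Gamma_pm s T a))
           < 2 * inverse \<delta> * T powr (1 + 2 / \<delta>) * (a - \<delta>) powr (- 2 * real s / \<delta>)"
proof -
  \<comment> \<open>The strict bound on \<open>Z\<close> survives the \<open>s\<close>-th power
    because \<open>s \<ge> 1\<close>. The factor \<open>c\<close> will be
    \<open>inverse \<delta>\<close> or \<open>2 * inverse \<delta>\<close>.\<close>
  have strict: "x < c * T powr (1 + p) * (a - \<delta>) powr (- p * real s)"
    if x: "x \<le> T powr (1 + p) * Z ^ s" and Z: "0 \<le> Z" "Z < (a - \<delta>) powr (-p)" and c: "1 \<le> c"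
    for x p Z c
  proof -
    have "x \<le> T powr (1 + p) * Z ^ s" by (rule x)
    also have "\<dots> < T powr (1 + p) * ((a - \<delta>) powr (-p)) ^ s"
      using Z assms by (intro mult_strict_left_mono power_strict_mono) auto
    also have "\<dots> \<le> c * (T powr (1 + p) * ((a - \<delta>) powr (-p)) ^ s)"
      using mult_right_mono[OF c, of "T powr (1 + p) * ((a - \<delta>) powr (-p)) ^ s"] by simp
    also have "((a - \<delta>) powr (-p)) ^ s = (a - \<delta>) powr (- p * real s)"
      using assms by (simp add: powr_powr flip: powr_realpow)
    finally show ?thesis by (simp add: mult.assoc)
  qed
  have c: "1 \<le> inverse \<delta>" using assms by (simp add: one_le_inverse)
  have le: "\<delta> * a powr (-p) \<le> a powr (-p)" for p
    using assms by (simp add: mult_le_cancel_right1)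

  let ?p = "1 / \<delta>" and ?Z = "a powr (-1 - 1/\<delta>) + a powr (-(1/\<delta>)) / (1/\<delta>)"
  have "finite {k. real k + a \<le> B}" for B
  proof (rule finite_subset)
    show "{k. real k + a \<le> B} \<subseteq> {..nat \<lceil>B\<rceil>}" using assms by (auto, linarith)
  qed simp
  then have nat_le: "finite (Gamma_nat s T a)" "real (card (Gamma_nat s T a)) \<le> T powr (1 + ?p) * ?Z ^ s"
    using card_prod_le[of "{1..s}" a "\<lambda>k. real k + a" "1 + ?p" ?Z T]
      sum_powr_nat_finite_le[of a ?p] assms
    unfolding Gamma_nat_def by auto
  \<comment> \<open>The choice \<open>?p = 1/\<delta>\<close> makes
    \<open>?p * \<delta> = 1\<close>, matching the \<open>k = 0\<close> term, and turns division by
    \<open>?p\<close> into multiplication by \<open>\<delta> \<le> 1\<close>.\<close>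
  have "?Z \<le> a powr (-?p) + ?p * \<delta> * a powr (-1 - ?p)"
    using le[of ?p] assms by (simp add: mult.commute)
  also have "\<dots> < (a - \<delta>) powr (-?p)"
    using assms by (intro powr_shift_Bernoulli) auto
  finally have "?Z < (a - \<delta>) powr (-?p)" .
  then have nat: "real (card (Gamma_nat s T a))
      < inverse \<delta> * T powr (1 + ?p) * (a - \<delta>) powr (- ?p * real s)"
    using nat_le c assms by (intro strict[where Z = ?Z]) auto

  let ?r = "2 / \<delta>" and ?Y = "a powr (-1 - 2/\<delta>) + 2 * a powr (-(2/\<delta>)) / (2/\<delta>)"
  have "finite {k::int. real_of_int \<bar>k\<bar> + a \<le> B}" for B
  proof (rule finite_subset)
    show "{k::int. real_of_int \<bar>k\<bar> + a \<le> B} \<subseteq> {-\<lceil>B\<rceil>..\<lceil>B\<rceil>}" using assms by (auto, linarith+)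
  qed simp
  then have pm_le: "finite (Gamma_pm s T a)" "real (card (Gamma_pm s T a)) \<le> T powr (1 + ?r) * ?Y ^ s"
    using card_prod_le[of "{1..s}" a "\<lambda>k. real_of_int \<bar>k\<bar> + a" "1 + ?r" ?Y T]
      sum_powr_int_finite_le[of a ?r] assms
    unfolding Gamma_pm_def by auto
  \<comment> \<open>With \<open>?r = 2/\<delta>\<close> the doubled tail again carries the factor
    \<open>2 / ?r = \<delta> \<le> 1\<close>. Since \<open>?r * \<delta> = 2\<close>, one copy of
    \<open>a powr (-1 - ?r)\<close> is left to spare.\<close>
  have "?Y \<le> a powr (-?r) + ?r * \<delta> * a powr (-1 - ?r)"
    using add_increasing[OF _ le[of ?r], of "a powr (-1 - ?r)"] assms by (simp add: mult.commute)
  also have "\<dots> < (a - \<delta>) powr (-?r)"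
    using assms by (intro powr_shift_Bernoulli) auto
  finally have "?Y < (a - \<delta>) powr (-?r)" .
  then have pm: "real (card (Gamma_pm s T a))
      < 2 * inverse \<delta> * T powr (1 + ?r) * (a - \<delta>) powr (- ?r * real s)"
    using pm_le c assms by (intro strict[where Z = ?Y]) auto
  show ?thesis using nat nat_le(1) pm pm_le(1) by simp
qed

end
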